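(* As formal power series in $y$, \[ \sum_{n\ge 0} D_n^-(x)y^n = \frac{1+xy-x^2y^3-x^2y^4}{1-y-xy^2}. \]
   Context: For $n\ge 0$, the $S$-fence $\phi_n$ is the poset on $\{x_1,\dots,x_n\}$ whose order is generated by the cover relations $x_2<x_1$, $x_3<x_2$, $x_2<x_4$, $x_5<x_4$, and, for every $i\ge 3$, $x_{2i-1}<x_{2i}$ and $x_{2i+1}<x_{2i}$, keeping only those relations whose elements both have index $\le n$ ($\phi_0$ is empty). A filter is an up-set. $\mathcal{F}(\phi_n)$ is the lattice of filters of $\phi_n$ ordered by reverse inclusion ($Y'\le Y$ iff $Y'\supseteq Y$). Its Hasse diagram $\Phi_n$ is viewed as a directed graph with an arc $(X,Y)$ whenever $Y$ is covered by $X$ in $\mathcal{F}(\phi_n)$; so the indegree of a filter $Y$ is the number of elements of $\mathcal{F}(\phi_n)$ covering $Y$, which equals the number of minimal elements of $Y$. $d^-_{n,k}$ is the number of vertices of indegree $k$ and $D_n^-(x)=\sum_{k\ge0}d^-_{n,k}x^k$. *)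

theory Defs
  imports
    "HOL-Computational_Algebra.Computational_Algebra"
    "Graph_Theory.Pair_Digraph"
begin

text \<open>
  A finite poset is given by its carrier \<open>A\<close> and its order \<open>r\<close>, a relation on \<open>A\<close> in which
  \<open>(a, b) \<in> r\<close> means \<open>a \<le> b\<close>.
\<close>

definition filters_on :: "'a set \<Rightarrow> 'a rel \<Rightarrow> 'a set set" where
  "filters_on A r = {Y. Y \<subseteq> A \<and> (\<forall>a\<in>Y. \<forall>b\<in>A. (a, b) \<in> r \<longrightarrow> b \<in> Y)}"

definition covered_by :: "'a rel \<Rightarrow> 'a \<Rightarrow> 'a \<Rightarrow> bool" where
  "covered_by r a b \<longleftrightarrow> (a, b) \<in> r \<and> a \<noteq> b \<and>
     (\<forall>c. (a, c) \<in> r \<and> (c, b) \<in> r \<longrightarrow> c = a \<or> c = b)"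

text \<open>Arcs point downwards: from the covering element to the covered one.\<close>

definition hasse_digraph :: "'a set \<Rightarrow> 'a rel \<Rightarrow> 'a pair_pre_digraph" where
  "hasse_digraph A r =
     \<lparr>pverts = A, parcs = {(b, a). b \<in> A \<and> a \<in> A \<and> covered_by r a b}\<rparr>"

text \<open>The element \<open>x\<^sub>i\<close> of the fence is represented by its index \<open>i\<close>.\<close>

definition fence_generators :: "nat \<Rightarrow> nat rel" where
  "fence_generators n =
     ({(2, 1), (3, 2), (2, 4), (5, 4)} \<union> (\<Union>i\<in>{3..}. {(2 * i - 1, 2 * i), (2 * i + 1, 2 * i)}))
       \<inter> {1..n} \<times> {1..n}"

definition fence_order :: "nat \<Rightarrow> nat rel" where
  "fence_order n = (fence_generators n)\<^sup>* \<inter> {1..n} \<times> {1..n}"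

definition fence_filters :: "nat \<Rightarrow> nat set set" where
  "fence_filters n = filters_on {1..n} (fence_order n)"

text \<open>Filters are ordered by reverse inclusion.\<close>

definition fence_filter_order :: "nat \<Rightarrow> nat set rel" where
  "fence_filter_order n =
     {(Y', Y). Y' \<in> fence_filters n \<and> Y \<in> fence_filters n \<and> Y \<subseteq> Y'}"

definition fence_filter_digraph :: "nat \<Rightarrow> nat set pair_pre_digraph" where
  "fence_filter_digraph n = hasse_digraph (fence_filters n) (fence_filter_order n)"

definition indegree_count :: "nat \<Rightarrow> nat \<Rightarrow> nat" where
  "indegree_count n k =
     card {Y \<in> pverts (fence_filter_digraph n). in_degree (with_proj (fence_filter_digraph n)) Y = k}"

text \<open>
  The sum over all \<open>k\<close> is restricted to the finitely many non-zero terms.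
\<close>

definition indegree_poly :: "nat \<Rightarrow> int poly" where
  "indegree_poly n = (\<Sum>k | indegree_count n k \<noteq> 0. monom (int (indegree_count n k)) k)"

lemma finite_fence_filters: "finite (fence_filters n)"
  by (rule finite_subset[of _ "Pow {1..n}"]) (auto simp: fence_filters_def filters_on_def)

lemma finite_indegree_support: "finite {k. indegree_count n k \<noteq> 0}"
proof (rule finite_subset)
  show "finite (in_degree (with_proj (fence_filter_digraph n)) ` fence_filters n)"
    by (intro finite_imageI finite_fence_filters)
  show "{k. indegree_count n k \<noteq> 0}
    \<subseteq> in_degree (with_proj (fence_filter_digraph n)) ` fence_filters n"
    by (auto simp: indegree_count_def fence_filter_digraph_def hasse_digraph_def card_eq_0_iff)
qed

lemma coeff_indegree_poly: "coeff (indegree_poly n) k = int (indegree_count n k)"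
  using finite_indegree_support[of n]
  by (auto simp: indegree_poly_def coeff_sum sum.delta' eq_commute[of _ k] coeff_monom)

lemma partial_order_on_fence_order: "partial_order_on {1..n} (fence_order n)"
proof -
  define rank :: "nat \<Rightarrow> nat"
    where "rank i = (if i = 2 then 1 else if i = 1 \<or> even i then 2 else 0)" for i
  have step: "rank a < rank b" if "(a, b) \<in> fence_generators n" for a b
    using that by (auto simp: fence_generators_def rank_def)
  have less: "rank a < rank b \<or> a = b" if "(a, b) \<in> (fence_generators n)\<^sup>*" for a b
    using that by induction (use step in fastforce)+
  have "antisym (fence_order n)"
  proof (rule antisymI)
    fix a b assume "(a, b) \<in> fence_order n" "(b, a) \<in> fence_order n"
    then show "a = b"
      using less[of a b] less[of b a] by (auto simp: fence_order_def)
  qed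
  moreover have "trans (fence_order n)"
    by (rule transI) (auto simp: fence_order_def)
  ultimately show ?thesis
    by (auto simp: partial_order_on_def preorder_on_def refl_on_def fence_order_def)
qed

lemma partial_order_on_fence_filter_order:
  "partial_order_on (fence_filters n) (fence_filter_order n)"
  by (auto simp: partial_order_on_def preorder_on_def refl_on_def fence_filter_order_def
      intro!: antisymI transI)

end

theory Submission
  imports Defs
begin

text \<open>
  The elements covering a filter \<open>Y\<close> are the sets \<open>Y - {m}\<close> with \<open>m\<close> minimal in \<open>Y\<close>, and a filter
  of a finite poset is determined by the antichain of its minimal elements. So \<open>D\<^sub>n\<^sup>-\<close> counts the
  antichains of the fence by their size. For \<open>n \<ge> 5\<close> the element \<open>x\<^sub>n\<close> is comparable to no other
  element of \<open>\<phi>\<^sub>n\<close> than \<open>x\<^bsub>n-1\<^esub>\<close>, so splitting the antichains according to whether they contain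
  \<open>x\<^sub>n\<close> gives \<open>D\<^sub>n\<^sup>- = D\<^bsub>n-1\<^esub>\<^sup>- + x D\<^bsub>n-2\<^esub>\<^sup>-\<close>.
\<close>

section \<open>Filters and antichains of a finite poset\<close>

definition minimal_elems :: "'a rel \<Rightarrow> 'a set \<Rightarrow> 'a set" where
  "minimal_elems r Y = {m \<in> Y. \<forall>b\<in>Y. (b, m) \<in> r \<longrightarrow> b = m}"

definition antichains_on :: "'a set \<Rightarrow> 'a rel \<Rightarrow> 'a set set" where
  "antichains_on A r = {S. S \<subseteq> A \<and> (\<forall>a\<in>S. \<forall>b\<in>S. (a, b) \<in> r \<longrightarrow> a = b)}"

lemma ex_minimal_elem:
  assumes "antisym r" "trans r" "finite S" "S \<noteq> {}"
  shows "\<exists>m. m \<in> minimal_elems r S"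
proof -
  have "\<exists>m\<in>S. \<forall>x\<in>S. x \<noteq> m \<longrightarrow> \<not> ((x, m) \<in> r \<and> x \<noteq> m)"
  proof (rule Finite_Set.bex_min_element[OF assms(3)])
    show "asymp_on S (\<lambda>x y. (x, y) \<in> r \<and> x \<noteq> y)"
      using assms(1) by (auto simp: asymp_on_def dest: antisymD)
    show "transp_on S (\<lambda>x y. (x, y) \<in> r \<and> x \<noteq> y)"
      using assms(1,2) by (auto simp: transp_on_def dest: antisymD transD)
  qed (fact assms(4))
  then show ?thesis by (auto simp: minimal_elems_def)
qed

text \<open>By transitivity, a minimal element of the part of \<open>Y\<close> below
  \<open>b\<close> is minimal in all of \<open>Y\<close>.\<close>

lemma ex_minimal_elem_below:
  assumes "refl_on A r" "antisym r" "trans r" "finite Y" "Y \<subseteq> A" "b \<in> Y"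
  shows "\<exists>m \<in> minimal_elems r Y. (m, b) \<in> r"
proof -
  have "b \<in> {c \<in> Y. (c, b) \<in> r}" using assms by (auto dest: refl_onD)
  then obtain m where "m \<in> minimal_elems r {c \<in> Y. (c, b) \<in> r}"
    using ex_minimal_elem[of r "{c \<in> Y. (c, b) \<in> r}"] assms by auto
  then show ?thesis using assms(3) by (auto simp: minimal_elems_def dest: transD)
qed

lemma filters_on_remove_minimal:
  assumes "Y \<in> filters_on A r" "m \<in> minimal_elems r Y"
  shows "Y - {m} \<in> filters_on A r"
  using assms by (auto simp: filters_on_def minimal_elems_def)

text \<open>The inverse sends an antichain to the up-set it generates. Finiteness of
  \<open>A\<close> puts every element of a filter above a minimal one, so the filter is
  recovered.\<close>

lemma bij_betw_minimal_elems:
  assumes "finite A" "partial_order_on A r"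
  shows "bij_betw (minimal_elems r) (filters_on A r) (antichains_on A r)"
proof (rule bij_betw_byWitness[where f' = "\<lambda>S. {b \<in> A. \<exists>a\<in>S. (a, b) \<in> r}"])
  have r: "refl_on A r" "trans r" "antisym r"
    using assms(2) by (auto simp: partial_order_on_def preorder_on_def)
  show "\<forall>Y\<in>filters_on A r. {b \<in> A. \<exists>a\<in>minimal_elems r Y. (a, b) \<in> r} = Y"
  proof
    fix Y assume Y: "Y \<in> filters_on A r"
    then have "Y \<subseteq> A" "finite Y"
      using assms(1) finite_subset by (auto simp: filters_on_def)
    then show "{b \<in> A. \<exists>a\<in>minimal_elems r Y. (a, b) \<in> r} = Y"
      using Y ex_minimal_elem_below[OF r(1,3,2), of Y]
      by (auto simp: filters_on_def minimal_elems_def)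
  qed
  show "\<forall>S\<in>antichains_on A r. minimal_elems r {b \<in> A. \<exists>a\<in>S. (a, b) \<in> r} = S"
  proof
    fix S assume S: "S \<in> antichains_on A r"
    let ?U = "{b \<in> A. \<exists>a\<in>S. (a, b) \<in> r}"
    have SU: "S \<subseteq> ?U" using S r(1) by (auto simp: antichains_on_def dest: refl_onD)
    show "minimal_elems r ?U = S"
    proof
      show "minimal_elems r ?U \<subseteq> S"
        using SU by (auto simp: minimal_elems_def)
      show "S \<subseteq> minimal_elems r ?U"
      proof
        fix a assume a: "a \<in> S"
        have "b = a" if "c \<in> S" "(c, b) \<in> r" "(b, a) \<in> r" for b c
        proof -
          have "(c, a) \<in> r" using that r(2) by (blast dest: transD)
          then have "c = a" using S a that(1) by (auto simp: antichains_on_def)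
          then show ?thesis using that r(3) by (auto dest: antisymD)
        qed
        then show "a \<in> minimal_elems r ?U"
          using a SU by (auto simp: minimal_elems_def)
      qed
    qed
  qed
  show "minimal_elems r ` filters_on A r \<subseteq> antichains_on A r"
    by (auto simp: filters_on_def minimal_elems_def antichains_on_def)
  show "(\<lambda>S. {b \<in> A. \<exists>a\<in>S. (a, b) \<in> r}) ` antichains_on A r \<subseteq> filters_on A r"
    using r(2) by (auto simp: filters_on_def dest: transD)
qed

section \<open>Covers and indegrees in the lattice of filters\<close>

lemma covered_by_filters_on_iff:
  fixes A :: "'a set" and r :: "'a rel"
  defines "R \<equiv> {(Y', Y). Y' \<in> filters_on A r \<and> Y \<in> filters_on A r \<and> Y \<subseteq> Y'}"
  assumes "finite A" "partial_order_on A r" "Y \<in> filters_on A r"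
  shows "X \<in> filters_on A r \<and> covered_by R Y X \<longleftrightarrow> (\<exists>m\<in>minimal_elems r Y. X = Y - {m})"
proof (intro iffI)
  have r: "trans r" "antisym r"
    using assms(3) by (auto simp: partial_order_on_def preorder_on_def)
  assume X: "X \<in> filters_on A r \<and> covered_by R Y X"
  then have sub: "X \<subset> Y"
    and max: "\<And>Z. Z \<in> filters_on A r \<Longrightarrow> Z \<subseteq> Y \<Longrightarrow> X \<subseteq> Z \<Longrightarrow> Z = Y \<or> Z = X"
    using assms(4) by (auto simp: covered_by_def R_def)
  have "finite (Y - X)"
    using assms(2,4) finite_subset[of Y A] by (auto simp: filters_on_def)
  then obtain m where m: "m \<in> minimal_elems r (Y - X)"
    using ex_minimal_elem[OF r(2,1)] sub by (metis Diff_eq_empty_iff psubsetE)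
  \<comment> \<open>An element of \<open>Y\<close> below \<open>m\<close> cannot lie in
    \<open>X\<close>, because the up-set \<open>X\<close> would then contain \<open>m\<close>; so it
    lies in \<open>Y - X\<close>, where \<open>m\<close> is minimal.\<close>
  have "m \<in> minimal_elems r Y"
    using m X assms(4) unfolding minimal_elems_def filters_on_def by blast
  \<comment> \<open>\<open>Y - {m}\<close> is a filter between \<open>X\<close> and \<open>Y\<close>
    other than \<open>Y\<close>, so the cover leaves only \<open>X\<close>.\<close>
  moreover from this have "X = Y - {m}"
    using max[OF filters_on_remove_minimal[OF assms(4)]] m sub
    by (auto simp: minimal_elems_def)
  ultimately show "\<exists>m\<in>minimal_elems r Y. X = Y - {m}" by blast
next
  assume "\<exists>m\<in>minimal_elems r Y. X = Y - {m}"
  then obtain m where m: "m \<in> minimal_elems r Y" "X = Y - {m}" by blast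
  then show "X \<in> filters_on A r \<and> covered_by R Y X"
    using assms(4) filters_on_remove_minimal[OF assms(4) m(1)]
    by (auto simp: covered_by_def R_def minimal_elems_def)
qed

lemma in_degree_fence_filter_digraph:
  assumes "Y \<in> fence_filters n"
  shows "in_degree (with_proj (fence_filter_digraph n)) Y = card (minimal_elems (fence_order n) Y)"
proof -
  have iff: "X \<in> fence_filters n \<and> covered_by (fence_filter_order n) Y X
      \<longleftrightarrow> (\<exists>m\<in>minimal_elems (fence_order n) Y. X = Y - {m})" for X
    unfolding fence_filters_def fence_filter_order_def
    by (rule covered_by_filters_on_iff)
      (use assms partial_order_on_fence_order in \<open>auto simp: fence_filters_def\<close>)
  have "in_arcs (with_proj (fence_filter_digraph n)) Y
      = (\<lambda>X. (X, Y)) ` {X \<in> fence_filters n. covered_by (fence_filter_order n) Y X}"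
    using assms by (auto simp: in_arcs_def fence_filter_digraph_def hasse_digraph_def)
  also have "\<dots> = (\<lambda>m. (Y - {m}, Y)) ` minimal_elems (fence_order n) Y"
    unfolding iff by blast
  finally have "in_arcs (with_proj (fence_filter_digraph n)) Y
      = (\<lambda>m. (Y - {m}, Y)) ` minimal_elems (fence_order n) Y" .
  moreover have "inj_on (\<lambda>m. (Y - {m}, Y)) (minimal_elems (fence_order n) Y)"
    by (auto simp: inj_on_def minimal_elems_def)
  ultimately show ?thesis by (simp add: in_degree_def card_image)
qed

text \<open>The indegree of a filter is the number of its minimal elements, so filters of indegree
  \<open>k\<close> correspond to antichains of size \<open>k\<close>.\<close>

lemma indegree_poly_eq_sum_antichains:
  "indegree_poly n = (\<Sum>S \<in> antichains_on {1..n} (fence_order n). monom 1 (card S))"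
proof (rule poly_eqI)
  fix k
  let ?a = "antichains_on {1..n} (fence_order n)"
  have fin: "finite ?a"
    by (rule finite_subset[of _ "Pow {1..n}"]) (auto simp: antichains_on_def)
  have bij: "bij_betw (minimal_elems (fence_order n)) (fence_filters n) ?a"
    unfolding fence_filters_def
    by (rule bij_betw_minimal_elems[OF _ partial_order_on_fence_order]) simp
  have "{Y \<in> pverts (fence_filter_digraph n).
          in_degree (with_proj (fence_filter_digraph n)) Y = k}
      = {Y \<in> fence_filters n. card (minimal_elems (fence_order n) Y) = k}"
    using in_degree_fence_filter_digraph
    by (auto simp: fence_filter_digraph_def hasse_digraph_def)
  moreover have "bij_betw (minimal_elems (fence_order n))
      {Y \<in> fence_filters n. card (minimal_elems (fence_order n) Y) = k} {S \<in> ?a. card S = k}"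
    by (rule bij_betw_subset[OF bij]) (unfold bij_betw_imp_surj_on[OF bij, symmetric], blast+)
  ultimately have "indegree_count n k = card {S \<in> ?a. card S = k}"
    by (simp add: indegree_count_def bij_betw_same_card)
  then show "coeff (indegree_poly n) k = coeff (\<Sum>S \<in> ?a. monom 1 (card S)) k"
    using fin by (simp add: coeff_indegree_poly coeff_sum sum.If_cases Int_def)
qed

section \<open>The fence order in closed form\<close>

text \<open>The order of the infinite fence: \<open>(3, 1)\<close> and \<open>(3, 4)\<close> are the
  only pairs that transitivity adds to the generators. Being independent of \<open>n\<close>, it
  serves fences of different lengths at once.\<close>

definition fence_le :: "nat rel" where
  "fence_le = Id \<union> {(2, 1), (3, 2), (2, 4), (5, 4), (3, 1), (3, 4)}
     \<union> (\<Union>i\<in>{3..}. {(2 * i - 1, 2 * i), (2 * i + 1, 2 * i)})"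

lemma fence_order_eq: "fence_order n = fence_le \<inter> {1..n} \<times> {1..n}"
proof -
  have "(a, b) \<in> fence_le" if "(a, b) \<in> (fence_generators n)\<^sup>*" for a b
    using that
  proof induction
    case base
    show ?case by (simp add: fence_le_def)
  next
    case (step b c)
    \<comment> \<open>A nontrivial chain of generators has reached either 2, coming from 3, or a
      maximal element, namely 1 or an even index from 4 on. Only the first kind can be
      continued.\<close>
    have "a = b \<or> (a, b) = (3, 2) \<or> b = 1 \<or> even b \<and> b \<ge> 4"
      using step.IH by (auto simp: fence_le_def)
    moreover have "b = 2 \<and> c \<in> {1, 4} \<or> odd b \<and> b \<ge> 3"
      using step.hyps(2) by (auto simp: fence_generators_def)
    ultimately have "a = b \<or> (a, b) = (3, 2) \<and> c \<in> {1, 4}" by auto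
    moreover have "(b, c) \<in> fence_le"
      using step.hyps(2) by (auto simp: fence_generators_def fence_le_def)
    ultimately show ?case by (auto simp: fence_le_def)
  qed
  moreover have "(a, b) \<in> (fence_generators n)\<^sup>*"
    if le: "(a, b) \<in> fence_le" and n: "a \<in> {1..n}" "b \<in> {1..n}" for a b
  proof -
    consider "a = b" | "(a, b) \<in> fence_generators n" | "(a, b) \<in> {(3, 1), (3, 4)}"
      using le n by (auto simp: fence_le_def fence_generators_def)
    then show ?thesis
    proof cases
      case 3
      then have "(a, 2) \<in> fence_generators n" "(2, b) \<in> fence_generators n"
        using n by (auto simp: fence_generators_def)
      then show ?thesis by (meson r_into_rtrancl rtrancl.rtrancl_into_rtrancl)
    qed auto
  qed
  ultimately show ?thesis by (auto simp: fence_order_def)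
qed

lemma antichains_on_fence_order:
  "antichains_on {1..n} (fence_order n) = antichains_on {1..n} fence_le"
  unfolding antichains_on_def fence_order_eq by (intro Collect_cong conj_cong refl) blast

section \<open>Counting antichains by size\<close>

lemma antichains_on_empty: "antichains_on {} r = {{}}"
  by (auto simp: antichains_on_def)

lemma finite_antichains_on: "finite A \<Longrightarrow> finite (antichains_on A r)"
  by (rule finite_subset[of _ "Pow A"]) (auto simp: antichains_on_def)

text \<open>Removing \<open>a\<close> from an antichain that contains it leaves an antichain of
  elements incomparable to \<open>a\<close>; the lost element accounts for the factor
  \<open>[:0, 1:]\<close>, the variable.\<close>

lemma sum_antichains_on_insert:
  fixes z :: "'a \<Rightarrow> 'b :: comm_semiring_1"
  assumes "finite A" "a \<notin> A"
    and B: "B = {b \<in> A. (a, b) \<notin> r \<and> (b, a) \<notin> r}"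
  shows "(\<Sum>S \<in> antichains_on (insert a A) r. monom (1 :: 'b) (card S))
    = (\<Sum>S \<in> antichains_on A r. monom 1 (card S))
      + [:0, 1:] * (\<Sum>S \<in> antichains_on B r. monom 1 (card S))"
proof -
  have finB: "finite B" using assms by simp
  have inj: "inj_on (insert a) (antichains_on B r)"
    using assms(2) B by (auto simp: inj_on_def antichains_on_def)
  have split: "antichains_on (insert a A) r = antichains_on A r \<union> insert a ` antichains_on B r"
  proof
    show "antichains_on (insert a A) r \<subseteq> antichains_on A r \<union> insert a ` antichains_on B r"
    proof
      fix S assume S: "S \<in> antichains_on (insert a A) r"
      show "S \<in> antichains_on A r \<union> insert a ` antichains_on B r"
      proof (cases "a \<in> S")
        case True
        then have "S - {a} \<in> antichains_on B r"
          using S by (auto simp: antichains_on_def B)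
        then show ?thesis using True by (metis UnI2 imageI insert_Diff)
      qed (use S in \<open>auto simp: antichains_on_def\<close>)
    qed
    show "antichains_on A r \<union> insert a ` antichains_on B r \<subseteq> antichains_on (insert a A) r"
      by (fastforce simp: antichains_on_def B)
  qed
  have disj: "antichains_on A r \<inter> insert a ` antichains_on B r = {}"
    using assms(2) by (auto simp: antichains_on_def)
  have card: "card (insert a S) = Suc (card S)" if "S \<in> antichains_on B r" for S
    using that assms finite_subset[OF _ finB, of S]
    by (subst card_insert_disjoint) (auto simp: antichains_on_def)
  have "(\<Sum>S \<in> antichains_on (insert a A) r. monom (1 :: 'b) (card S))
    = (\<Sum>S \<in> antichains_on A r. monom 1 (card S))
      + (\<Sum>S \<in> insert a ` antichains_on B r. monom 1 (card S))"
    unfolding split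
    by (rule sum.union_disjoint) (simp_all add: disj assms(1) finB finite_antichains_on)
  also have "(\<Sum>S \<in> insert a ` antichains_on B r. monom (1 :: 'b) (card S))
    = [:0, 1:] * (\<Sum>S \<in> antichains_on B r. monom 1 (card S))"
    by (simp add: sum.reindex[OF inj] card monom_Suc sum_distrib_left)
  finally show ?thesis .
qed

text \<open>When the elements incomparable to the new one form an initial segment, the second sum is
  again a polynomial of the family. Leaving \<open>m\<close> free covers the irregular start as
  well.\<close>

lemma indegree_poly_Suc:
  assumes "{b \<in> {1..n}. (Suc n, b) \<notin> fence_le \<and> (b, Suc n) \<notin> fence_le} = {1..m}"
  shows "indegree_poly (Suc n) = indegree_poly n + [:0, 1:] * indegree_poly m"
  unfolding indegree_poly_eq_sum_antichains antichains_on_fence_order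
  using sum_antichains_on_insert[of "{1..n}" "Suc n" "{1..m}" fence_le, where 'b = int] assms
  by (simp add: atLeastAtMostSuc_conv)

text \<open>The bound makes the new index at least 5: index 4 is comparable to both 2 and 3.\<close>

lemma indegree_poly_rec:
  assumes "n \<ge> 3"
  shows "indegree_poly (n + 2) = indegree_poly (n + 1) + [:0, 1:] * indegree_poly n"
proof -
  have "(n + 2, n + 1) \<in> fence_le \<or> (n + 1, n + 2) \<in> fence_le"
  \<comment> \<open>The pair \<open>(5, 4)\<close> stands outside the family indexed by
    \<open>i \<ge> 3\<close>, which starts at \<open>(5, 6)\<close>.\<close>
  proof (cases "n = 3")
    case False
    have "\<exists>i\<ge>3. n + 2 = 2 * i \<and> n + 1 = 2 * i - 1 \<or> n + 1 = 2 * i \<and> n + 2 = 2 * i + 1"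
      using assms False by presburger
    then show ?thesis by (auto simp: fence_le_def)
  qed (simp add: fence_le_def)
  moreover have "(n + 2, b) \<notin> fence_le \<and> (b, n + 2) \<notin> fence_le" if "b \<le> n" for b
    using that assms by (auto simp: fence_le_def)
  ultimately have "{b \<in> {1..n+1}. (Suc (n + 1), b) \<notin> fence_le \<and> (b, Suc (n + 1)) \<notin> fence_le}
      = {1..n}"
    by (auto simp: le_Suc_eq)
  from indegree_poly_Suc[OF this] show ?thesis by simp
qed

text \<open>The first three elements form a chain, so each new one has no incomparable predecessor
  (\<open>{1..0}\<close> is empty). Index 4 is incomparable to 1 alone, and the antichain of 1 and 4
  gives the quadratic term.\<close>

lemma indegree_poly_initial:
  "indegree_poly 0 = 1" "indegree_poly 1 = [:1, 1:]" "indegree_poly 2 = [:1, 2:]"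
  "indegree_poly 3 = [:1, 3:]" "indegree_poly 4 = [:1, 4, 1:]"
proof -
  show p0: "indegree_poly 0 = 1"
    by (simp add: indegree_poly_eq_sum_antichains antichains_on_empty)
  show p1: "indegree_poly 1 = [:1, 1:]"
    using indegree_poly_Suc[of 0 0] p0 by (simp add: one_pCons)
  have "{b \<in> {1..1}. (Suc 1, b) \<notin> fence_le \<and> (b, Suc 1) \<notin> fence_le} = {1..0}"
    by (auto simp: fence_le_def)
  from indegree_poly_Suc[OF this] p0 p1 show p2: "indegree_poly 2 = [:1, 2:]"
    by (simp add: numeral_2_eq_2)
  have "{b \<in> {1..2}. (Suc 2, b) \<notin> fence_le \<and> (b, Suc 2) \<notin> fence_le} = {1..0}"
    by (auto simp: fence_le_def le_Suc_eq numeral_eq_Suc)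
  from indegree_poly_Suc[OF this] show p3: "indegree_poly 3 = [:1, 3:]"
    by (simp add: p0 p2)
  have "{b \<in> {1..3}. (Suc 3, b) \<notin> fence_le \<and> (b, Suc 3) \<notin> fence_le} = {1..1}"
    by (auto simp: fence_le_def le_Suc_eq numeral_eq_Suc)
  from indegree_poly_Suc[OF this] p1 show "indegree_poly 4 = [:1, 4, 1:]"
    by (simp add: p3)
qed

section \<open>The generating function\<close>

theorem theorem7:
  "let x = fps_const (to_fract [:0, 1:]) :: int poly fract fps; y = fps_X
   in Abs_fps (\<lambda>n. to_fract (indegree_poly n)) =
      (1 + x * y - x ^ 2 * y ^ 3 - x ^ 2 * y ^ 4) / (1 - y - x * y ^ 2)"
proof -
  define c where "c = to_fract ([:0, 1:] :: int poly)"
  define F where "F = Abs_fps (\<lambda>n. to_fract (indegree_poly n))"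
  define N where "N = 1 + fps_const c * fps_X - fps_const c ^ 2 * fps_X ^ 3
    - fps_const c ^ 2 * fps_X ^ 4"
  define D where "D = 1 - fps_X - fps_const c * fps_X ^ 2"
  have F_nth: "fps_nth F n = to_fract (indegree_poly n)" for n by (simp add: F_def)
  have "F * D = N"
  proof (rule fps_ext)
    fix n
    have FD: "F * D = F - F * fps_X - fps_const c * (F * fps_X ^ 2)"
      by (simp add: D_def algebra_simps)
    \<comment> \<open>Multiplication by \<open>fps_X\<close> shifts coefficients; the conditionals
      supply the zeros below the shift, where subtraction on \<open>nat\<close> would give index
      0.\<close>
    have FD_nth: "fps_nth (F * D) n = to_fract (indegree_poly n
        - (if n = 0 then 0 else indegree_poly (n - 1))
        - [:0, 1:] * (if n < 2 then 0 else indegree_poly (n - 2)))"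
      unfolding FD by (simp add: F_nth fps_X_power_mult_right_nth c_def
          del: mult_pCons_left mult_pCons_right)
    have N_nth: "fps_nth N n = to_fract (if n = 0 then 1 else if n = 1 then [:0, 1:]
        else if n = 3 \<or> n = 4 then - ([:0, 1:] ^ 2) else 0)"
      unfolding N_def by (auto simp: c_def power2_eq_square
          simp del: mult_pCons_left mult_pCons_right)
    \<comment> \<open>The recurrence settles all indices from 5 on. Below that it also holds at 2,
      while its defects at 1, 3 and 4 are the nonconstant terms of the numerator.\<close>
    consider "n = 0" | "n = 1" | "n = 2" | "n = 3" | "n = 4" | m where "m \<ge> 3" "n = m + 2"
    proof -
      have "n \<in> {0, 1, 2, 3, 4} \<or> n - 2 \<ge> 3 \<and> n = n - 2 + 2" by auto
      then show thesis using that by blast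
    qed
    then show "fps_nth (F * D) n = fps_nth N n"
      unfolding FD_nth N_nth to_fract_eq_iff
      by cases (use indegree_poly_initial indegree_poly_rec in \<open>simp_all add: power2_eq_square one_pCons\<close>)
  qed
  \<comment> \<open>The constant coefficient of \<open>D\<close> is 1, so \<open>D\<close> can be
    cancelled from \<open>F * D = N\<close>.\<close>
  moreover have "D \<noteq> 0"
  proof
    assume "D = 0"
    then have "fps_nth D 0 = 0" by simp
    then show False by (simp add: D_def)
  qed
  ultimately have "F = N / D"
    by (metis nonzero_mult_div_cancel_right)
  then show ?thesis by (simp add: F_def N_def D_def c_def Let_def)
qed

end
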